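(* Let $G=C_n^r\oplus C_{kn}$ with $r\in\mathbb N_+$ and $n,k\in \mathbb N_{\ge 2}$, and suppose that $G$ is not a group of prime power order. Let $p$ be a prime divisor of $n$, let $k_1\in \mathbb N_{\geq 2}$ be a divisor of $k$ with $\gcd(p,k_1)=1$, and let $m\in\mathbb N$ be such that $kn=k_1m$. If $\ell\in \mathbb N_+$ and $t\in [1,k_1-1]$ is an integer with $r \ge t\, \theta(\ell;p)\ge 1$, then $$\mathsf D(G) \ge \mathsf D^*(G) + t(p - 1)\ell - tm.$$
   Context: $C_n$ denotes the cyclic group of order $n$, written additively, and $\mathbb N_+$ denotes the positive integers. A sequence over a finite abelian group $G$ is a finite unordered sequence (multiset) of elements of $G$, repetition allowed; it is zero-sum if its terms sum to $0$. The Davenport constant $\mathsf D(G)$ is the smallest integer $d$ such that every sequence over $G$ of length at least $d$ (counted with multiplicity) has a nonempty zero-sum subsequence. If $G\cong C_{n_1}\oplus\dots\oplus C_{n_s}$ with $1<n_1\mid\dots\mid n_s$, then $\mathsf D^*(G)=1+\sum_{i=1}^s(n_i-1)$. For a prime $p$ and $\ell\in\mathbb N_+$, $$\theta(\ell;p)=\begin{cases}\frac{2(p^\ell-1)}{p-1}-\ell, & p>2,\\ 2^\ell-1-\ell, & p=2.\end{cases}$$ *)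

theory Defs
  imports
    "HOL-Library.Multiset"
    "HOL-Algebra.FiniteProduct"
    "HOL-Algebra.Product_Groups"
    "HOL-Number_Theory.Prime_Powers"
begin

text \<open>Groups are written multiplicatively, following HOL-Algebra: the sum of a sequence is a
  product in \<open>G\<close>, and ``zero-sum'' means that this product is \<open>\<one>\<^bsub>G\<^esub>\<close>.\<close>

definition seq_sum :: "('a, 'b) monoid_scheme \<Rightarrow> 'a multiset \<Rightarrow> 'a" where
  "seq_sum G S = (\<Otimes>\<^bsub>G\<^esub>x\<in>set_mset S. x [^]\<^bsub>G\<^esub> count S x)"

definition zero_sum :: "('a, 'b) monoid_scheme \<Rightarrow> 'a multiset \<Rightarrow> bool" where
  "zero_sum G S \<longleftrightarrow> seq_sum G S = \<one>\<^bsub>G\<^esub>"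

definition davenport :: "('a, 'b) monoid_scheme \<Rightarrow> nat" where
  "davenport G = (LEAST d. \<forall>S. set_mset S \<subseteq> carrier G \<and> d \<le> size S \<longrightarrow>
     (\<exists>T. T \<subseteq># S \<and> T \<noteq> {#} \<and> zero_sum G T))"

definition invariant_factors :: "('a, 'b) monoid_scheme \<Rightarrow> nat list \<Rightarrow> bool" where
  "invariant_factors G ns \<longleftrightarrow>
     (\<forall>n\<in>set ns. 1 < n) \<and> sorted_wrt (dvd) ns \<and>
     G \<cong> product_group {..<length ns} (\<lambda>i. integer_mod_group (ns ! i))"

text \<open>For a finite abelian group the list of invariant factors exists and is unique, so the
  definite description denotes. The trivial group has the empty list and the value \<open>1\<close>.\<close>

definition davenport_star :: "('a, 'b) monoid_scheme \<Rightarrow> nat" where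
  "davenport_star G = (THE d. \<exists>ns. invariant_factors G ns \<and> d = 1 + (\<Sum>n\<leftarrow>ns. n - 1))"

text \<open>The division is exact, since \<open>p - 1\<close> divides \<open>p ^ l - 1\<close>.\<close>

definition theta :: "nat \<Rightarrow> nat \<Rightarrow> int" where
  "theta l p = (if p = 2 then 2 ^ l - 1 - int l
                else (2 * (int p ^ l - 1)) div (int p - 1) - int l)"

end

(* Let e_1, ..., e_r, f be the standard generators of C_n^r + C_kn. The sequence in which f occurs
   kn - 1 times and every e_i occurs n - 1 times is zero-sum free and has length D*(G) - 1. Omitting
   tm copies of f makes room for t l further terms of multiplicity p - 1, each a combination of the
   (n/p) e_i and f: a subsequence with sum in the span of f that does not consist of copies of f alone
   amounts to t words, not all zero, of a code over F_p whose coordinates are the projective points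
   (taken with both signs if p is odd). All nonzero words have the same weight, a power of p.
   Adding a suitable multiple of f to the generators involved, every nonzero word contributes
   exactly m f, so the sum is j f with 0 < j < kn. *)

theory Submission
  imports Defs "HOL-Algebra.Multiplicative_Group" "HOL-Number_Theory.Cong"
begin

section \<open>Sequences over a finite abelian group\<close>

context comm_group
begin

text \<open>Padding the support lets two sequences be summed over one index set, as
  \<open>seq_sum_union\<close> does.\<close>

lemma seq_sum_eq_finprod:
  assumes "finite A" "set_mset S \<subseteq> A" "A \<subseteq> carrier G"
  shows "seq_sum G S = (\<Otimes>x\<in>A. x [^] count S x)"
  unfolding seq_sum_def
  by (rule finprod_mono_neutral_cong_left)
     (use assms in \<open>auto simp: not_in_iff\<close>)

lemma seq_sum_empty [simp]: "seq_sum G {#} = \<one>"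
  by (simp add: seq_sum_def)

lemma seq_sum_union:
  assumes "set_mset S \<subseteq> carrier G" "set_mset T \<subseteq> carrier G"
  shows "seq_sum G (S + T) = seq_sum G S \<otimes> seq_sum G T"
proof -
  let ?A = "set_mset S \<union> set_mset T"
  have "seq_sum G (S + T) = (\<Otimes>x\<in>?A. x [^] (count S x + count T x))"
    using assms by (subst seq_sum_eq_finprod[of ?A]) auto
  also have "\<dots> = (\<Otimes>x\<in>?A. x [^] count S x \<otimes> x [^] count T x)"
    using assms by (intro finprod_cong') (auto simp: nat_pow_mult)
  also have "\<dots> = (\<Otimes>x\<in>?A. x [^] count S x) \<otimes> (\<Otimes>x\<in>?A. x [^] count T x)"
    using assms by (intro finprod_multf) auto
  also have "\<dots> = seq_sum G S \<otimes> seq_sum G T"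
    using assms by (simp add: seq_sum_eq_finprod[of ?A])
  finally show ?thesis .
qed

lemma seq_sum_replicate_mset:
  assumes "x \<in> carrier G"
  shows "seq_sum G (replicate_mset n x) = x [^] n"
  using assms by (subst seq_sum_eq_finprod[of "{x}"]) auto

text \<open>\<open>LEAST\<close> has its defining property only once some admissible length is
  known; the square of the group order is one, by pigeonhole.\<close>

lemma davenport_property:
  assumes "finite (carrier G)" "set_mset S \<subseteq> carrier G" "davenport G \<le> size S"
  shows "\<exists>T. T \<subseteq># S \<and> T \<noteq> {#} \<and> zero_sum G T"
proof -
  let ?P = "\<lambda>d. \<forall>S. set_mset S \<subseteq> carrier G \<and> d \<le> size S \<longrightarrow>
     (\<exists>T. T \<subseteq># S \<and> T \<noteq> {#} \<and> zero_sum G T)"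
  have pos: "0 < order G"
    using assms(1) by (auto simp: order_def card_gt_0_iff)
  have "?P (order G * order G)"
  proof (intro allI impI, elim conjE)
    fix S assume S: "set_mset S \<subseteq> carrier G" "order G * order G \<le> size S"
    \<comment> \<open>Otherwise at most \<open>order G\<close> distinct terms would each occur fewer
      than \<open>order G\<close> times. The \<open>order G\<close> copies of such an
      \<open>x\<close> are zero-sum by Lagrange.\<close>
    have "\<exists>x\<in>set_mset S. order G \<le> count S x"
    proof (rule ccontr)
      assume "\<not> ?thesis"
      then have less: "\<And>x. x \<in># S \<Longrightarrow> count S x < order G" by force
      have "S \<noteq> {#}" using S(2) pos by auto
      then have "size S < (\<Sum>x\<in>set_mset S. order G)"
        unfolding size_multiset_overloaded_eq by (intro sum_strict_mono) (auto simp: less)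
      also have "\<dots> \<le> order G * order G"
        using S(1) assms(1) by (simp add: card_mono order_def)
      finally show False using S(2) by simp
    qed
    then obtain x where x: "x \<in># S" "order G \<le> count S x" by blast
    then have "x \<in> carrier G" using S(1) by auto
    then have "zero_sum G (replicate_mset (order G) x)"
      by (simp add: zero_sum_def seq_sum_replicate_mset pow_order_eq_1)
    moreover have "replicate_mset (order G) x \<subseteq># S"
      using x(2) by (simp add: count_le_replicate_mset_subset_eq)
    ultimately show "\<exists>T. T \<subseteq># S \<and> T \<noteq> {#} \<and> zero_sum G T"
      using pos by (metis replicate_mset_eq_empty_iff less_irrefl)
  qed
  then have "?P (davenport G)"
    unfolding davenport_def by (rule LeastI)
  then show ?thesis using assms by blast
qed

lemma seq_sum_sum_replicate_mset:
  assumes "finite I" "w \<in> I \<rightarrow> carrier G"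
  shows "seq_sum G (\<Sum>i\<in>I. replicate_mset (c i) (w i)) = (\<Otimes>i\<in>I. w i [^] c i)"
  using assms
proof (induction I rule: finite_induct)
  case (insert i I)
  have "set_mset (\<Sum>i\<in>I. replicate_mset (c i) (w i)) \<subseteq> carrier G"
    using insert by (auto simp: set_mset_sum split: if_splits)
  moreover have "set_mset (replicate_mset (c i) (w i)) \<subseteq> carrier G"
    using insert.prems by auto
  ultimately show ?case
    using insert by (subst sum.insert, simp, simp, subst seq_sum_union)
      (auto simp: seq_sum_replicate_mset Pi_iff)
qed simp

end

text \<open>The \<open>w i\<close> may coincide, so \<open>T\<close> does not determine the
  \<open>c i\<close> and they have to be chosen: the induction assigns to the new index only those
  copies that the remaining family cannot supply.\<close>

lemma subseteq_sum_replicate_msetE: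
  assumes "finite I" "T \<subseteq># (\<Sum>i\<in>I. replicate_mset (N i) (w i))"
  obtains c where "\<And>i. i \<in> I \<Longrightarrow> c i \<le> N i" "T = (\<Sum>i\<in>I. replicate_mset (c i) (w i))"
proof -
  have "\<exists>c. (\<forall>i\<in>I. c i \<le> N i) \<and> T = (\<Sum>i\<in>I. replicate_mset (c i) (w i))"
    using assms
  proof (induction I arbitrary: T rule: finite_induct)
    case (insert i I)
    let ?R = "\<Sum>i\<in>I. replicate_mset (N i) (w i)"
    have T: "T \<subseteq># replicate_mset (N i) (w i) + ?R"
      using insert by simp
    then have "T - ?R \<subseteq># replicate_mset (N i) (w i)"
      by (simp add: subset_eq_diff_conv)
    then obtain a where a: "a \<le> N i" "T - ?R = replicate_mset a (w i)"
      by (rule msubseteq_replicate_msetE)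
    have "T \<inter># ?R \<subseteq># ?R" by simp
    then obtain c where c: "\<forall>i\<in>I. c i \<le> N i"
      "T \<inter># ?R = (\<Sum>i\<in>I. replicate_mset (c i) (w i))"
      using insert.IH by blast
    have "T = (T - ?R) + (T \<inter># ?R)"
      by (auto simp: multiset_eq_iff min_def)
    also have "\<dots> = (\<Sum>j\<in>insert i I. replicate_mset ((c(i := a)) j) (w j))"
      unfolding a(2) c(2) using insert.hyps by (auto intro!: sum.cong)
    finally show ?case
      using a(1) c(1) by (intro exI[of _ "c(i := a)"]) auto
  qed simp
  then show ?thesis using that by blast
qed

text \<open>Lower bounds come from zero-sum free sequences. Stating freeness through multiplicities
  \<open>c\<close> over an index set avoids any injectivity requirement on \<open>w\<close>.\<close>

lemma (in comm_group) davenport_gt_sum: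
  assumes "finite (carrier G)" "finite I" "w \<in> I \<rightarrow> carrier G"
    and free: "\<And>c. (\<And>i. i \<in> I \<Longrightarrow> c i \<le> N i) \<Longrightarrow> (\<Otimes>i\<in>I. w i [^] (c i :: nat)) = \<one>
      \<Longrightarrow> (\<And>i. i \<in> I \<Longrightarrow> c i = 0)"
  shows "(\<Sum>i\<in>I. N i) < davenport G"
proof (rule ccontr)
  let ?S = "\<Sum>i\<in>I. replicate_mset (N i) (w i)"
  assume "\<not> ?thesis"
  then have "davenport G \<le> size ?S" by simp
  moreover have "set_mset ?S \<subseteq> carrier G"
    using assms by (auto simp: set_mset_sum split: if_splits)
  ultimately obtain T where T: "T \<subseteq># ?S" "T \<noteq> {#}" "zero_sum G T"
    using davenport_property assms(1) by blast
  from assms(2) T(1) obtain c where c: "\<And>i. i \<in> I \<Longrightarrow> c i \<le> N i"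
    "T = (\<Sum>i\<in>I. replicate_mset (c i) (w i))"
    by (rule subseteq_sum_replicate_msetE) blast
  have "\<And>i. i \<in> I \<Longrightarrow> c i = 0"
    using free[of c] c T(3) seq_sum_sum_replicate_mset[OF assms(2,3), of c]
    by (simp add: zero_sum_def)
  then show False using c(2) T(2) by simp
qed

section \<open>Uniqueness of the invariant factors\<close>

lemma card_torsion_iso:
  assumes "group G" "group H" "G \<cong> H"
  shows "card {x \<in> carrier G. x [^]\<^bsub>G\<^esub> (d::nat) = \<one>\<^bsub>G\<^esub>} = card {x \<in> carrier H. x [^]\<^bsub>H\<^esub> d = \<one>\<^bsub>H\<^esub>}"
proof -
  obtain h where h: "h \<in> hom G H" "bij_betw h (carrier G) (carrier H)"
    using assms(3) by (auto simp: is_iso_def iso_def)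
  then interpret group_hom G H h
    using assms by (simp add: group_hom_def group_hom_axioms_def)
  have inj: "inj_on h (carrier G)" and surj: "h ` carrier G = carrier H"
    using h(2) by (auto simp: bij_betw_def)
  have eq: "h x [^]\<^bsub>H\<^esub> d = \<one>\<^bsub>H\<^esub> \<longleftrightarrow> x [^]\<^bsub>G\<^esub> d = \<one>\<^bsub>G\<^esub>" if "x \<in> carrier G" for x
    using that inj by (metis G.nat_pow_closed G.one_closed hom_nat_pow hom_one inj_onD)
  have "{x \<in> carrier H. x [^]\<^bsub>H\<^esub> d = \<one>\<^bsub>H\<^esub>} = h ` {x \<in> carrier G. x [^]\<^bsub>G\<^esub> d = \<one>\<^bsub>G\<^esub>}"
    using surj[symmetric] by (auto simp: eq)
  moreover have "inj_on h {x \<in> carrier G. x [^]\<^bsub>G\<^esub> d = \<one>\<^bsub>G\<^esub>}"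
    using inj by (rule inj_on_subset) auto
  ultimately show ?thesis by (simp add: card_image)
qed

text \<open>With \<open>d = g * u\<close>, \<open>n = g * v\<close> and \<open>u\<close>,
  \<open>v\<close> coprime, \<open>n\<close> divides \<open>d * x\<close> exactly if
  \<open>v\<close> divides \<open>x\<close>, and there are \<open>g\<close> multiples of
  \<open>v\<close> from 0 to \<open>n - 1\<close>.\<close>

lemma card_torsion_integer_mod_group:
  assumes "0 < n"
  shows "card {x \<in> carrier (integer_mod_group n). x [^]\<^bsub>integer_mod_group n\<^esub> d = \<one>\<^bsub>integer_mod_group n\<^esub>} = gcd d n"
proof -
  obtain u v where uv: "d = gcd d n * u" "n = gcd d n * v" "coprime u v"
    using gcd_coprime_exists[of d n] assms by (metis gcd_eq_0_iff less_irrefl mult.commute)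
  define g where "g = gcd d n"
  have g: "0 < g" "0 < v" "d = g * u" "n = g * v" using uv assms by (auto simp: g_def intro: Nat.gr0I)
  have dvd: "int n dvd int d * x \<longleftrightarrow> int v dvd x" for x
    using g uv(3) by (simp add: mult.assoc coprime_dvd_mult_right_iff coprime_commute)
  have "{x \<in> carrier (integer_mod_group n). x [^]\<^bsub>integer_mod_group n\<^esub> d = \<one>\<^bsub>integer_mod_group n\<^esub>}
      = {x \<in> {0..<int n}. int v dvd x}"
    using assms by (simp add: carrier_integer_mod_group mod_eq_0_iff_dvd dvd del: of_nat_mult)
  also have "\<dots> = (\<lambda>y. int v * y) ` {0..<int g}"
    using g by (auto simp: dvd_def image_iff mult.commute zero_le_mult_iff)
  also have "card \<dots> = g"
    using g by (subst card_image) (auto simp: inj_on_def)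
  finally show ?thesis by (simp add: g_def)
qed

lemma pow_product_group:
  "x [^]\<^bsub>product_group I G\<^esub> (d::nat) = (\<lambda>i\<in>I. x i [^]\<^bsub>G i\<^esub> d)"
  by (induction d) (auto simp: product_group_def)

lemma card_torsion_product_group:
  assumes "finite I" "\<And>i. i \<in> I \<Longrightarrow> group (G i)"
  shows "card {x \<in> carrier (product_group I G). x [^]\<^bsub>product_group I G\<^esub> (d::nat) = \<one>\<^bsub>product_group I G\<^esub>}
    = (\<Prod>i\<in>I. card {x \<in> carrier (G i). x [^]\<^bsub>G i\<^esub> d = \<one>\<^bsub>G i\<^esub>})"
proof -
  have "{x \<in> carrier (product_group I G). x [^]\<^bsub>product_group I G\<^esub> (d::nat) = \<one>\<^bsub>product_group I G\<^esub>}
    = (\<Pi>\<^sub>E i\<in>I. {x \<in> carrier (G i). x [^]\<^bsub>G i\<^esub> d = \<one>\<^bsub>G i\<^esub>})"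
  proof -
    have "x [^]\<^bsub>product_group I G\<^esub> d = \<one>\<^bsub>product_group I G\<^esub> \<longleftrightarrow> (\<forall>i\<in>I. x i [^]\<^bsub>G i\<^esub> d = \<one>\<^bsub>G i\<^esub>)"
      if "x \<in> carrier (product_group I G)" for x
      unfolding pow_product_group one_product_group by (auto simp: fun_eq_iff restrict_def)
    then show ?thesis by (auto simp: PiE_iff extensional_def simp del: one_product_group)
  qed
  then show ?thesis using assms(1) by (simp add: card_PiE)
qed

section \<open>Recovering a divisibility chain from its products of gcds\<close>

lemma dvd_if_prod_gcd_eq:
  fixes a :: nat
  assumes "x \<in> set xs" "\<And>x. x \<in> set xs \<Longrightarrow> 0 < x" "(\<Prod>x\<leftarrow>xs. gcd a x) = prod_list xs"
  shows "x dvd a"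
proof -
  have le: "(\<Prod>x\<leftarrow>xs. gcd a x) \<le> prod_list xs" if "\<And>x. x \<in> set xs \<Longrightarrow> 0 < x" for xs
    using that by (induction xs) (auto intro!: mult_le_mono simp: gcd_le2_nat)
  have pos: "0 < prod_list xs" if "\<And>x. x \<in> set xs \<Longrightarrow> 0 < x" for xs :: "nat list"
    using that by (induction xs) auto
  \<comment> \<open>Every \<open>gcd a y\<close> is at most \<open>y\<close>, so a strict loss at
    \<open>x\<close> could not be made up by the other factors.\<close>
  obtain ys zs where xs: "xs = ys @ x # zs"
    using assms(1) by (meson split_list)
  have "x * prod_list (ys @ zs) = prod_list xs"
    by (simp add: xs ac_simps)
  also have "\<dots> = gcd a x * (\<Prod>y\<leftarrow>ys @ zs. gcd a y)"
    unfolding assms(3)[symmetric] by (simp add: xs mult.left_commute)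
  also have "\<dots> \<le> gcd a x * prod_list (ys @ zs)"
    using assms(2) by (intro mult_le_mono2 le) (auto simp: xs)
  finally have "x * prod_list (ys @ zs) \<le> gcd a x * prod_list (ys @ zs)" .
  moreover have "0 < prod_list (ys @ zs)"
    using pos[of "ys @ zs"] assms(2) xs by auto
  ultimately have "x \<le> gcd a x" by (metis mult_le_cancel2)
  then have "gcd a x = x"
    using assms(1) assms(2)[of x] by (intro le_antisym gcd_le2_nat) simp_all
  then show ?thesis by (metis gcd_dvd1)
qed

lemma prod_gcd_eq_prod_list:
  fixes a :: nat
  assumes "\<And>x. x \<in> set xs \<Longrightarrow> x dvd a"
  shows "(\<Prod>x\<leftarrow>xs. gcd a x) = prod_list xs"
  using assms by (induction xs) (auto simp: gcd_nat.absorb2)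

text \<open>The last entry of a chain is a multiple of all others. Once the last entries are known
  to agree, their factors cancel and the induction proceeds from the end.\<close>

lemma divisibility_chain_eqI:
  fixes xs ys :: "nat list"
  assumes "\<forall>x\<in>set xs. 1 < x" "sorted_wrt (dvd) xs"
    and "\<forall>y\<in>set ys. 1 < y" "sorted_wrt (dvd) ys"
    and "\<And>d. 0 < d \<Longrightarrow> (\<Prod>x\<leftarrow>xs. gcd d x) = (\<Prod>y\<leftarrow>ys. gcd d y)"
  shows "xs = ys"
  using assms
proof (induction xs arbitrary: ys rule: rev_induct)
  case Nil
  show ?case
  proof (cases ys)
    case (Cons y ys')
    then show ?thesis using Nil.prems(3) Nil.prems(5)[of y] by simp
  qed simp
next
  case (snoc a xs)
  show ?case
  proof (cases ys rule: rev_cases)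
    case Nil
    then show ?thesis using snoc.prems(1) snoc.prems(5)[of a] by auto
  next
    case ys: (snoc ys' b)
    have pos: "\<And>x. x \<in> set (xs @ [a]) \<Longrightarrow> 0 < x" "\<And>x. x \<in> set ys \<Longrightarrow> 0 < x"
      using snoc.prems(1,3) by force+
    have dva: "\<And>x. x \<in> set (xs @ [a]) \<Longrightarrow> x dvd a" and dvb: "\<And>x. x \<in> set ys \<Longrightarrow> x dvd b"
      using snoc.prems(2,4) ys by (auto simp: sorted_wrt_append)
    have ab: "0 < a" "0 < b" using pos ys by auto
    \<comment> \<open>\<open>a * b\<close> is a common multiple of all entries, so both gcd products
      are the full products. Evaluating at \<open>b\<close> and at \<open>a\<close> then yields
      divisibility in both directions.\<close>
    have "prod_list (xs @ [a]) = (\<Prod>x\<leftarrow>xs @ [a]. gcd (a * b) x)"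
      using dva by (intro prod_gcd_eq_prod_list[symmetric]) simp
    also have "\<dots> = (\<Prod>y\<leftarrow>ys. gcd (a * b) y)"
      using ab by (intro snoc.prems(5)) simp
    also have "\<dots> = prod_list ys"
      using dvb by (intro prod_gcd_eq_prod_list) simp
    finally have eq: "prod_list (xs @ [a]) = prod_list ys" .
    have "a dvd b"
    proof (rule dvd_if_prod_gcd_eq)
      show "(\<Prod>x\<leftarrow>xs @ [a]. gcd b x) = prod_list (xs @ [a])"
        using snoc.prems(5)[OF ab(2)] prod_gcd_eq_prod_list[OF dvb] eq by simp
    qed (use pos in auto)
    moreover have "b dvd a"
    proof (rule dvd_if_prod_gcd_eq)
      show "(\<Prod>y\<leftarrow>ys. gcd a y) = prod_list ys"
        using snoc.prems(5)[OF ab(1)] prod_gcd_eq_prod_list[OF dva] eq by simp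
      show "b \<in> set ys" by (simp add: ys)
    qed (use pos in auto)
    ultimately have [simp]: "b = a" by (simp add: dvd_antisym)
    have "xs = ys'"
    proof (rule snoc.IH)
      fix d :: nat assume "0 < d"
      then show "(\<Prod>x\<leftarrow>xs. gcd d x) = (\<Prod>y\<leftarrow>ys'. gcd d y)"
        using snoc.prems(5)[of d] ys by simp
    qed (use snoc.prems(1-4) ys in \<open>auto simp: sorted_wrt_append\<close>)
    then show ?thesis by (simp add: ys)
  qed
qed

text \<open>The number of elements killed by \<open>d\<close> is invariant under isomorphism and
  equals the product of the gcds of \<open>d\<close> with the invariant factors. This makes the
  description in \<open>davenport_star\<close> denote.\<close>

lemma invariant_factors_unique:
  assumes "group G" "invariant_factors G ms" "invariant_factors G ns"
  shows "ms = ns"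
proof -
  have *: "card {x \<in> carrier G. x [^]\<^bsub>G\<^esub> d = \<one>\<^bsub>G\<^esub>} = (\<Prod>n\<leftarrow>ns. gcd d n)"
    if "invariant_factors G ns" for ns and d :: nat
  proof -
    let ?P = "product_group {..<length ns} (\<lambda>i. integer_mod_group (ns ! i))"
    have pos: "0 < ns ! i" if "i < length ns" for i
      using \<open>invariant_factors G ns\<close> nth_mem[OF that] by (auto simp: invariant_factors_def)
    have "card {x \<in> carrier G. x [^]\<^bsub>G\<^esub> d = \<one>\<^bsub>G\<^esub>} = card {x \<in> carrier ?P. x [^]\<^bsub>?P\<^esub> d = \<one>\<^bsub>?P\<^esub>}"
      using that assms(1) by (intro card_torsion_iso) (auto simp: invariant_factors_def)
    also have "\<dots> = (\<Prod>i<length ns. gcd d (ns ! i))"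
      by (subst card_torsion_product_group, simp, simp)
        (intro prod.cong refl card_torsion_integer_mod_group pos, simp)
    also have "\<dots> = (\<Prod>n\<leftarrow>ns. gcd d n)"
      by (simp add: prod.list_conv_set_nth atLeast0LessThan)
    finally show ?thesis .
  qed
  show ?thesis
  proof (rule divisibility_chain_eqI)
    show "(\<Prod>m\<leftarrow>ms. gcd d m) = (\<Prod>n\<leftarrow>ns. gcd d n)" for d
      using *[OF assms(2), of d] *[OF assms(3), of d] by (rule trans[OF sym])
  qed (use assms(2,3) in \<open>auto simp: invariant_factors_def\<close>)
qed

lemma davenport_star_eq:
  assumes "group G" "invariant_factors G ns"
  shows "davenport_star G = 1 + (\<Sum>n\<leftarrow>ns. n - 1)"
  unfolding davenport_star_def
  using assms invariant_factors_unique[OF assms(1)] by (intro the_equality) blast+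

section \<open>A constant weight code\<close>

text \<open>The vectors of F_p^l with entries from 0 to \<open>p - 1\<close>, extended by zero. The
  order matters: the zero vector comes first, so that \<open>tl\<close> removes exactly it.\<close>

fun vecs :: "nat \<Rightarrow> nat \<Rightarrow> (nat \<Rightarrow> int) list" where
  "vecs p 0 = [\<lambda>_. 0]"
| "vecs p (Suc l) = concat (map (\<lambda>y. map (\<lambda>v. v(l := int y)) (vecs p l)) [0..<p])"

lemma length_vecs: "length (vecs p l) = p ^ l"
  by (induction l) (simp_all add: length_concat o_def sum_list_triv)

lemma vecs_Cons:
  assumes "0 < p"
  shows "vecs p l = (\<lambda>_. 0) # tl (vecs p l)"
proof -
  have "\<exists>vs. vecs p l = (\<lambda>_. 0) # vs"
  proof (induction l)
    case (Suc l)
    then obtain vs where "vecs p l = (\<lambda>_. 0) # vs" by blast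
    then show ?case using assms by (simp add: upt_conv_Cons fun_upd_idem)
  qed simp
  then show ?thesis by auto
qed

section \<open>Distribution of the values of linear forms over F_p\<close>

abbreviation dot :: "nat \<Rightarrow> (nat \<Rightarrow> int) \<Rightarrow> (nat \<Rightarrow> int) \<Rightarrow> int" where
  "dot l v d \<equiv> \<Sum>j<l. v j * d j"

lemma dot_upd [simp]: "dot l (v(l := y)) d = dot l v d"
  by (intro sum.cong) auto

text \<open>As \<open>b\<close> is a unit modulo \<open>p\<close>, the map from \<open>y\<close> to
  \<open>a + y * b\<close> permutes the residues.\<close>

lemma sum_upt_shift_periodic:
  fixes h :: "int \<Rightarrow> int"
  assumes "0 < p" "coprime b (int p)" "\<And>x. h (x mod int p) = h x"
  shows "(\<Sum>y<p. h (a + int y * b)) = (\<Sum>y<p. h (int y))"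
proof -
  define f where "f y = nat ((a + int y * b) mod int p)" for y
  have f: "int (f y) = (a + int y * b) mod int p" for y
    using assms(1) by (simp add: f_def)
  have "inj_on f {..<p}"
  proof (rule inj_onI)
    fix y z assume yz: "y \<in> {..<p}" "z \<in> {..<p}" "f y = f z"
    then have "[a + int y * b = a + int z * b] (mod int p)"
      using f by (metis cong_def)
    then have "[int y = int z] (mod int p)"
      using assms(2) by (simp add: cong_add_lcancel cong_mult_rcancel)
    then show "y = z" using yz by (simp add: cong_def)
  qed
  moreover have "f ` {..<p} \<subseteq> {..<p}"
    using assms(1) by (auto simp: f_def nat_less_iff)
  ultimately have "bij_betw f {..<p} {..<p}"
    by (simp add: bij_betw_def card_image card_subset_eq)
  then have "(\<Sum>y<p. h (int y)) = (\<Sum>y<p. h (int (f y)))"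
    by (rule sum.reindex_bij_betw[symmetric])
  then show ?thesis by (simp add: f assms(3))
qed

lemma sum_list_concat_map:
  fixes h :: "'b \<Rightarrow> 'c :: comm_monoid_add"
  shows "(\<Sum>v\<leftarrow>concat (map F ys). h v) = (\<Sum>y\<leftarrow>ys. \<Sum>v\<leftarrow>F y. h v)"
  by (induction ys) simp_all

lemma sum_sum_list_swap:
  fixes h :: "'a \<Rightarrow> 'b \<Rightarrow> 'c :: comm_monoid_add"
  shows "(\<Sum>y\<in>A. \<Sum>v\<leftarrow>vs. h y v) = (\<Sum>v\<leftarrow>vs. \<Sum>y\<in>A. h y v)"
  by (induction vs) (simp_all add: sum.distrib)

text \<open>A nonzero linear form takes every residue equally often, namely
  \<open>p ^ (l - 1)\<close> times. Summing a periodic \<open>h\<close> expresses this without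
  counting fibres.\<close>

lemma sum_vecs_periodic:
  fixes h :: "int \<Rightarrow> int"
  assumes "prime p" "\<And>x. h (x mod int p) = h x"
    and "\<exists>j<l. \<not> int p dvd d j"
  shows "(\<Sum>v\<leftarrow>vecs p l. h (dot l v d)) = int p ^ (l - 1) * (\<Sum>y<p. h (int y))"
  using assms(2,3)
proof (induction l arbitrary: h)
  case (Suc l)
  have p: "0 < p" using assms(1) by (simp add: prime_gt_0_nat)
  have eq: "(\<Sum>v\<leftarrow>vecs p (Suc l). h (dot (Suc l) v d)) = (\<Sum>v\<leftarrow>vecs p l. \<Sum>y<p. h (dot l v d + int y * d l))"
    by (simp add: sum_list_concat_map o_def interv_sum_list_conv_sum_set_nat atLeast0LessThan
        sum_sum_list_swap del: map_concat)
  show ?case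
  proof (cases "int p dvd d l")
    \<comment> \<open>The values are equidistributed already along the last coordinate, whatever the
      other coordinates are.\<close>
    case False
    then have "coprime (d l) (int p)"
      using assms(1) by (metis coprime_commute prime_imp_coprime prime_nat_int_transfer)
    then show ?thesis
      unfolding eq using p Suc.prems(1)
      by (simp add: sum_upt_shift_periodic sum_list_triv length_vecs)
  next
    \<comment> \<open>The last coordinate does not affect the residue and only contributes a factor
      \<open>p\<close>. Some earlier coefficient is a unit, so \<open>l\<close> is positive and
      \<open>l - 1\<close> is not truncated.\<close>
    case True
    then obtain c where c: "d l = int p * c" by (auto simp: dvd_def)
    have "h (x + int y * d l) = h x" for x y
      using Suc.prems(1)[of "x + int y * d l"] Suc.prems(1)[of x]
      by (simp add: c mult.left_commute)
    moreover have *: "\<exists>j<l. \<not> int p dvd d j"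
      using Suc.prems(2) True less_Suc_eq by auto
    then have "l \<noteq> 0" by auto
    ultimately show ?thesis
      unfolding eq using Suc.IH[of h, OF Suc.prems(1) *]
      by (cases l) (simp_all add: sum_list_const_mult)
  qed
qed simp

lemma sum_vecs_zero:
  fixes h :: "int \<Rightarrow> int"
  assumes "\<And>j. j < l \<Longrightarrow> d j = 0"
  shows "(\<Sum>v\<leftarrow>vecs p l. h (dot l v d)) = int p ^ l * h 0"
  using assms by (simp add: sum_list_triv length_vecs)

text \<open>Together with the unit vectors these are representatives of the points of projective space,
  each taken with both signs if \<open>p\<close> is odd. Opposite signs contribute \<open>p\<close> in total to the sum of
  the residues of a nonzero linear form unless it vanishes at the point, so that this sum does
  not depend on the form.\<close>

fun simplex :: "nat \<Rightarrow> nat \<Rightarrow> (nat \<Rightarrow> int) list" where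
  "simplex p 0 = []"
| "simplex p (Suc l) = map (\<lambda>v. v(l := 0)) (simplex p l) @ map (\<lambda>v. v(l := 1)) (tl (vecs p l))
    @ (if p = 2 then [] else map (\<lambda>v. v(l := -1)) (vecs p l))"

text \<open>With the \<open>l\<close> omitted unit vectors the points number
  \<open>(p ^ l - 1) / (p - 1)\<close>, doubled if \<open>p\<close> is odd. The induction clears the
  denominator.\<close>

lemma length_simplex:
  assumes "prime p"
  shows "int (length (simplex p l)) = theta l p"
proof -
  have p: "2 \<le> p" using assms by (simp add: prime_ge_2_nat)
  have eq: "(int p - 1) * (int (length (simplex p l)) + int l) = (if p = 2 then 1 else 2) * (int p ^ l - 1)"
  proof (induction l)
    case (Suc l)
    have "int (p ^ l - 1) = int p ^ l - 1" using p by (simp add: of_nat_diff)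
    then have "int (length (simplex p (Suc l))) + int (Suc l)
      = (int (length (simplex p l)) + int l) + (if p = 2 then 1 else 2) * int p ^ l"
      by (simp add: length_vecs)
    with Suc show ?case
      by (simp only: distrib_left) (auto simp: algebra_simps)
  qed simp
  show ?thesis
  proof (cases "p = 2")
    case False
    have "theta l p = ((int p - 1) * (int (length (simplex p l)) + int l)) div (int p - 1) - int l"
      using False by (simp add: theta_def eq)
    then show ?thesis using p by simp
  qed (use eq in \<open>auto simp: theta_def\<close>)
qed

text \<open>The sum of the \<open>d j\<close> is the contribution of the omitted unit vectors. In
  the induction, the layer with last coordinate 0 is the hypothesis, and the layers 1 and -1 become
  full copies of \<open>vecs p l\<close>.\<close>

lemma simplex_weight:
  assumes "prime p" "\<And>j. j < l \<Longrightarrow> d j \<in> {0..<int p}"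
    and "\<exists>j<l. d j \<noteq> 0"
  shows "(\<Sum>v\<leftarrow>simplex p l. dot l v d mod int p) + (\<Sum>j<l. d j) = (if p = 2 then 2 ^ (l - 1) else int p ^ l)"
  using assms(2,3)
proof (induction l)
  case (Suc l)
  have p: "2 \<le> p" using assms(1) by (simp add: prime_ge_2_nat)
  define f where "f x = (x + d l) mod int p" for x
  define g where "g x = (x - d l) mod int p" for x
  have dl: "0 \<le> d l" "d l < int p" using Suc.prems(1)[of l] by auto
  \<comment> \<open>The zero vector dropped by \<open>tl\<close> stands for the new unit vector; its
    value \<open>d l\<close> is the new term of the second sum and completes the layer.\<close>
  have "(\<Sum>v\<leftarrow>vecs p l. f (dot l v d)) = (\<Sum>v\<leftarrow>tl (vecs p l). f (dot l v d)) + d l"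
    using p dl by (subst (1) vecs_Cons) (auto simp: f_def)
  then have "(\<Sum>v\<leftarrow>simplex p (Suc l). dot (Suc l) v d mod int p) + (\<Sum>j<Suc l. d j)
    = (\<Sum>v\<leftarrow>simplex p l. dot l v d mod int p) + (\<Sum>j<l. d j) + (\<Sum>v\<leftarrow>vecs p l. f (dot l v d))
      + (if p = 2 then 0 else \<Sum>v\<leftarrow>vecs p l. g (dot l v d))"
    by (simp add: f_def g_def o_def)
  also have "\<dots> = (if p = 2 then 2 ^ l else int p ^ Suc l)"
  proof (cases "\<exists>j<l. d j \<noteq> 0")
    case True
    then have l: "l \<noteq> 0" by auto
    have nd: "\<exists>j<l. \<not> int p dvd d j"
      using True Suc.prems(1) by (metis atLeastLessThan_iff less_Suc_eq mod_pos_pos_trivial dvd_imp_mod_0)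
    \<comment> \<open>By equidistribution each full layer contributes
      \<open>p ^ (l - 1) * s\<close>. As \<open>2 * s = p * (p - 1)\<close>, one layer for
      \<open>p = 2\<close>, or two for odd \<open>p\<close>, multiply the weight by
      \<open>p\<close>.\<close>
    define s where "s = (\<Sum>y<p. int y)"
    have "(\<Sum>y<p. f (int y)) = s"
      using sum_upt_shift_periodic[of p 1 "\<lambda>x. x mod int p" "d l"] p
      by (simp add: f_def s_def add.commute)
    moreover have "(\<Sum>y<p. g (int y)) = s"
      using sum_upt_shift_periodic[of p 1 "\<lambda>x. x mod int p" "- d l"] p
      by (simp add: g_def s_def)
    moreover have s: "2 * s = int p * (int p - 1)"
    proof -
      have "2 * (\<Sum>y<q. int y) = int q * (int q - 1)" for q
        by (induction q) (auto simp: algebra_simps)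
      then show ?thesis by (simp add: s_def)
    qed
    ultimately have fg: "(\<Sum>v\<leftarrow>vecs p l. f (dot l v d)) = int p ^ (l - 1) * s"
      "(\<Sum>v\<leftarrow>vecs p l. g (dot l v d)) = int p ^ (l - 1) * s"
      using sum_vecs_periodic[OF assms(1) _ nd, of f] sum_vecs_periodic[OF assms(1) _ nd, of g]
      by (simp_all add: f_def g_def mod_simps)
    have IH: "(\<Sum>v\<leftarrow>simplex p l. dot l v d mod int p) + (\<Sum>j<l. d j) = (if p = 2 then 2 ^ (l - 1) else int p ^ l)"
      using Suc True by simp
    show ?thesis
    proof (cases "p = 2")
      case True
      then have "s = 1" using s by simp
      then show ?thesis unfolding IH fg using True l by (cases l) simp_all
    next
      case False
      have "int p ^ l + (int p ^ (l - 1) * s + int p ^ (l - 1) * s) = int p ^ l + int p ^ (l - 1) * (2 * s)"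
        by simp
      also have "\<dots> = int p ^ Suc l"
        unfolding s using l by (cases l) (simp_all add: algebra_simps)
      finally show ?thesis unfolding IH fg using False by simp
    qed
  next
    \<comment> \<open>Only the last coefficient is nonzero, so each layer is constant:
      \<open>d l\<close> on layer 1 and \<open>p - d l\<close> on layer -1. For \<open>p = 2\<close>
      there is only the former, with \<open>d l = 1\<close>.\<close>
    case False
    then have z: "\<And>j. j < l \<Longrightarrow> d j = 0" by auto
    have "d l \<noteq> 0" using Suc.prems(2) z less_Suc_eq by auto
    then have "f 0 = d l" "g 0 = int p - d l"
      using dl by (auto simp: f_def g_def zmod_zminus1_eq_if)
    moreover have "p = 2 \<Longrightarrow> d l = 1" using \<open>d l \<noteq> 0\<close> dl by simp
    moreover have "(\<Sum>v\<leftarrow>simplex p l. dot l v d mod int p) = 0" using z by (simp add: sum_list_0)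
    moreover have "(\<Sum>v\<leftarrow>vecs p l. f (dot l v d)) = int p ^ l * f 0"
      "(\<Sum>v\<leftarrow>vecs p l. g (dot l v d)) = int p ^ l * g 0"
      using z by (simp_all only: sum_vecs_zero)
    moreover have "int p ^ l * d l + int p ^ l * (int p - d l) = int p * int p ^ l"
      by (simp add: algebra_simps)
    ultimately show ?thesis using z by simp
  qed
  finally show ?case by simp
qed simp

section \<open>Coordinates\<close>

text \<open>Absorbs the extra cyclic summand as index \<open>r\<close>, so that all coordinates are
  treated uniformly.\<close>

lemma product_group_Suc_iso:
  "product_group {..<r} A \<times>\<times> A r \<cong> product_group {..<Suc r} A"
proof -
  let ?D = "product_group {..<r} A \<times>\<times> A r" and ?P = "product_group {..<Suc r} A"
  let ?h = "\<lambda>u. (fst u)(r := snd u)"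
  have P: "carrier ?P = (\<Pi>\<^sub>E i\<in>insert r {..<r}. carrier (A i))"
    by (simp only: carrier_product_group lessThan_Suc)
  have h: "?h u \<in> carrier ?P" if "u \<in> carrier ?D" for u
    unfolding P using that by (intro PiE_fun_upd) (simp_all add: mem_Times_iff)
  have "?h \<in> iso ?D ?P"
  proof (rule isoI)
    show "?h \<in> hom ?D ?P"
    proof (rule homI)
      fix u v assume "u \<in> carrier ?D" "v \<in> carrier ?D"
      obtain x y where u: "u = (x, y)" by (cases u)
      obtain x' y' where v: "v = (x', y')" by (cases v)
      show "?h (u \<otimes>\<^bsub>?D\<^esub> v) = ?h u \<otimes>\<^bsub>?P\<^esub> ?h v"
        by (rule ext) (simp add: u v restrict_def less_Suc_eq)
    qed (rule h)
    show "bij_betw ?h (carrier ?D) (carrier ?P)"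
    proof (rule bij_betw_byWitness[where f' = "\<lambda>z. (restrict z {..<r}, z r)"])
      show "\<forall>u\<in>carrier ?D. (restrict (?h u) {..<r}, ?h u r) = u"
      proof
        fix u assume "u \<in> carrier ?D"
        then have "fst u \<in> (\<Pi>\<^sub>E i\<in>{..<r}. carrier (A i))" by (simp add: mem_Times_iff)
        then have "restrict (?h u) {..<r} = fst u"
          by (intro ext) (simp add: restrict_def PiE_iff extensional_def)
        then show "(restrict (?h u) {..<r}, ?h u r) = u" by simp
      qed
      show "\<forall>z\<in>carrier ?P. ?h (restrict z {..<r}, z r) = z"
        unfolding P by (intro ballI ext) (simp add: restrict_def PiE_iff extensional_def)
      show "?h ` carrier ?D \<subseteq> carrier ?P" using h by (rule image_subsetI)
      show "(\<lambda>z. (restrict z {..<r}, z r)) ` carrier ?P \<subseteq> carrier ?D"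
        unfolding P by (intro image_subsetI) (simp add: PiE_iff)
    qed
  qed
  then show ?thesis by (rule is_isoI)
qed

lemma product_group_cong:
  assumes "\<And>i. i \<in> I \<Longrightarrow> A i = B i"
  shows "product_group I A = product_group I B"
proof -
  have "carrier (product_group I A) = carrier (product_group I B)"
    using assms by (simp cong: PiE_cong)
  moreover have "monoid.mult (product_group I A) = monoid.mult (product_group I B)"
    using assms by (simp cong: restrict_cong)
  moreover have "one (product_group I A) = one (product_group I B)"
    using assms by (simp cong: restrict_cong)
  ultimately show ?thesis by simp
qed

lemma rank_invariant_factors:
  assumes "G \<cong> product_group {..<r} (\<lambda>_. integer_mod_group n) \<times>\<times> integer_mod_group (k * n)"
    and "2 \<le> n" "2 \<le> k"
  shows "invariant_factors G (replicate r n @ [k * n])"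
proof -
  let ?ns = "replicate r n @ [k * n]"
  let ?A = "\<lambda>i. integer_mod_group (?ns ! i)"
  have "product_group {..<r} (\<lambda>_. integer_mod_group n) = product_group {..<r} ?A"
    by (rule product_group_cong) (simp add: nth_append)
  then have "G \<cong> product_group {..<r} ?A \<times>\<times> ?A r"
    using assms(1) by (simp add: nth_append)
  also have "product_group {..<r} ?A \<times>\<times> ?A r \<cong> product_group {..<Suc r} ?A"
    by (rule product_group_Suc_iso)
  finally have "G \<cong> product_group {..<length ?ns} ?A" by simp
  moreover have "\<forall>x\<in>set ?ns. 1 < x"
  proof -
    have "1 * 1 < k * n" using assms(2,3) by (intro mult_strict_mono) auto
    then show ?thesis using assms(2) by auto
  qed
  moreover have "sorted_wrt (dvd) ?ns"
  proof -
    have "sorted_wrt (dvd) (replicate r n)" by (induction r) auto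
    then show ?thesis by (simp add: sorted_wrt_append)
  qed
  ultimately show ?thesis by (simp add: invariant_factors_def)
qed

text \<open>\<open>\<psi>\<close> is reduction modulo the \<open>m i\<close> followed by an
  isomorphism onto \<open>G\<close>. Zero-sum conditions become divisibilities between integers that
  need not be reduced.\<close>

lemma coordinates:
  assumes "group G" "G \<cong> product_group I (\<lambda>i. integer_mod_group (m i))" "\<And>i. i \<in> I \<Longrightarrow> 0 < m i"
  shows "\<exists>\<psi>. (\<forall>u. \<psi> u \<in> carrier G) \<and> (\<forall>u v. \<psi> (\<lambda>i. u i + v i) = \<psi> u \<otimes>\<^bsub>G\<^esub> \<psi> v) \<and>
    (\<forall>u. \<psi> u = \<one>\<^bsub>G\<^esub> \<longleftrightarrow> (\<forall>i\<in>I. int (m i) dvd u i))"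
proof -
  let ?P = "product_group I (\<lambda>i. integer_mod_group (m i))"
  have "?P \<cong> G" using assms(1,2) by (rule group.iso_sym)
  then obtain h where h: "h \<in> hom ?P G" "bij_betw h (carrier ?P) (carrier G)"
    by (auto simp: is_iso_def iso_def)
  then interpret group_hom ?P G h
    using assms(1) by (simp add: group_hom_def group_hom_axioms_def)
  define red where "red u = (\<lambda>i\<in>I. u i mod int (m i))" for u
  have red: "red u \<in> carrier ?P" for u
    using assms(3) by (auto simp: red_def carrier_integer_mod_group)
  show ?thesis
  proof (intro exI[of _ "\<lambda>u. h (red u)"] conjI allI)
    show "h (red u) \<in> carrier G" for u
      using red by (rule hom_closed)
    show "h (red (\<lambda>i. u i + v i)) = h (red u) \<otimes>\<^bsub>G\<^esub> h (red v)" for u v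
    proof -
      have "red (\<lambda>i. u i + v i) = red u \<otimes>\<^bsub>?P\<^esub> red v"
        by (auto simp: red_def mod_simps)
      then show ?thesis using red by (simp only: hom_mult)
    qed
    show "h (red u) = \<one>\<^bsub>G\<^esub> \<longleftrightarrow> (\<forall>i\<in>I. int (m i) dvd u i)" for u
    proof -
      have "h (red u) = \<one>\<^bsub>G\<^esub> \<longleftrightarrow> red u = \<one>\<^bsub>?P\<^esub>"
        using h(2) red[of u] G.one_closed hom_one unfolding bij_betw_def by (metis inj_onD)
      also have "\<dots> \<longleftrightarrow> (\<forall>i\<in>I. int (m i) dvd u i)"
        by (auto simp: red_def fun_eq_iff restrict_def dvd_eq_mod_eq_0)
      finally show ?thesis .
    qed
  qed
qed

text \<open>Transports \<open>davenport_gt_sum\<close> along \<open>coordinates\<close>, so that the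
  freeness still to be shown concerns integers only.\<close>

lemma davenport_gt_coordinates:
  fixes G :: "('a, 'b) monoid_scheme" (structure) and w :: "'j \<Rightarrow> 'i \<Rightarrow> int"
  assumes "comm_group G" "G \<cong> product_group I (\<lambda>i. integer_mod_group (m i))"
    and "finite I" "\<And>i. i \<in> I \<Longrightarrow> 0 < m i" "finite J"
    and free: "\<And>c j. \<lbrakk>\<And>j. j \<in> J \<Longrightarrow> c j \<le> N j;
      \<And>i. i \<in> I \<Longrightarrow> int (m i) dvd (\<Sum>j\<in>J. int (c j) * w j i); j \<in> J\<rbrakk> \<Longrightarrow> c j = (0 :: nat)"
  shows "(\<Sum>j\<in>J. N j) < davenport G"
proof -
  interpret comm_group G by fact
  obtain \<psi> :: "('i \<Rightarrow> int) \<Rightarrow> 'a" where \<psi>: "\<And>u. \<psi> u \<in> carrier G"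
    "\<And>u v. \<psi> (\<lambda>i. u i + v i) = \<psi> u \<otimes> \<psi> v"
    "\<And>u. \<psi> u = \<one> \<longleftrightarrow> (\<forall>i\<in>I. int (m i) dvd u i)"
    using coordinates[OF is_group assms(2,4)] by blast
  have zero: "\<psi> (\<lambda>_. 0) = \<one>" by (simp add: \<psi>(3))
  have pow: "\<psi> u [^] c = \<psi> (\<lambda>i. int c * u i)" for u and c :: nat
  proof (induction c)
    case (Suc c)
    have "\<psi> u [^] Suc c = \<psi> (\<lambda>i. int c * u i) \<otimes> \<psi> u" by (simp add: Suc)
    also have "\<dots> = \<psi> (\<lambda>i. int c * u i + u i)" by (rule \<psi>(2)[symmetric])
    finally show ?case by (simp add: algebra_simps)
  qed (simp add: zero)
  have prod: "(\<Otimes>j\<in>J. \<psi> (w j) [^] c j) = \<psi> (\<lambda>i. \<Sum>j\<in>J. int (c j) * w j i)" for c :: "'j \<Rightarrow> nat"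
    using \<open>finite J\<close>
  proof (induction J rule: finite_induct)
    case (insert j J)
    then have "(\<Otimes>j\<in>insert j J. \<psi> (w j) [^] c j)
        = \<psi> (\<lambda>i. int (c j) * w j i) \<otimes> \<psi> (\<lambda>i. \<Sum>j\<in>J. int (c j) * w j i)"
      by (simp add: \<psi>(1) pow Pi_iff)
    also have "\<dots> = \<psi> (\<lambda>i. int (c j) * w j i + (\<Sum>j\<in>J. int (c j) * w j i))"
      by (rule \<psi>(2)[symmetric])
    finally show ?case using insert.hyps by simp
  qed (simp add: zero)
  have fin: "finite (carrier G)"
    using assms(2-4) by (subst iso_finite[OF assms(2)])
      (auto intro!: finite_PiE simp: carrier_integer_mod_group)
  show ?thesis
  proof (rule davenport_gt_sum[where w = "\<lambda>j. \<psi> (w j)"])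
    fix c j
    assume "\<And>j. j \<in> J \<Longrightarrow> c j \<le> N j" "(\<Otimes>j\<in>J. \<psi> (w j) [^] (c j :: nat)) = \<one>" "j \<in> J"
    then show "c j = 0" using free[of c j] by (simp add: prod \<psi>(3))
  qed (use fin assms \<psi>(1) in auto)
qed

section \<open>The lower bound\<close>

text \<open>\<open>p ^ e\<close> will be the common weight of the nonzero words. With
  \<open>y\<close> inverse to \<open>p ^ e\<close> modulo \<open>k\<^sub>1\<close>, take
  \<open>x = p * (m / n) * y\<close>: the factor \<open>p\<close> cancels the denominator of
  \<open>n div p\<close>, and the error \<open>m * (p ^ e * y - 1)\<close> is a multiple of
  \<open>k\<^sub>1 * m\<close>.\<close>

lemma height_exists:
  fixes p k\<^sub>1 n m e :: nat
  assumes "coprime p k\<^sub>1" "p dvd n" "n dvd m"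
  shows "\<exists>x. int (k\<^sub>1 * m) dvd int (n div p) * x * int p ^ e - int m"
proof -
  have "coprime (int p ^ e) (int k\<^sub>1)" using assms(1) by simp
  then obtain y where "[int p ^ e * y = 1] (mod int k\<^sub>1)"
    using cong_solve_coprime_int by blast
  then have y: "int k\<^sub>1 dvd int p ^ e * y - 1"
    by (simp add: cong_iff_dvd_diff)
  obtain q where q: "m = n * q" using assms(3) by (auto simp: dvd_def)
  have n: "int (n div p) * int p = int n"
    using assms(2) by (metis dvd_div_mult_self of_nat_mult)
  have "int (n div p) * (int p * int q * y) * int p ^ e - int m
      = (int (n div p) * int p) * int q * (int p ^ e * y) - int n * int q"
    by (simp add: q ac_simps)
  also have "\<dots> = int m * (int p ^ e * y - 1)"
    unfolding n by (simp add: q algebra_simps)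
  finally have "int (k\<^sub>1 * m) dvd int (n div p) * (int p * int q * y) * int p ^ e - int m"
    using y by (simp add: mult.commute[of "int k\<^sub>1"] mult_dvd_mono)
  then show ?thesis by blast
qed

text \<open>Coordinates (modulo \<open>n\<close> for \<open>q < r\<close>, modulo \<open>k n\<close> for \<open>q = r\<close>) of the terms of the sequence:
  \<open>Inl r\<close> is \<open>f\<close>, \<open>Inl i\<close> is \<open>e\<^sub>i\<close>, translated by \<open>x f\<close> if it lies in one of the blocks, and \<open>Inr (b, j)\<close>
  is the \<open>j\<close>-th of the additional terms of the block \<open>b\<close>.\<close>

definition seq_coord :: "nat \<Rightarrow> nat \<Rightarrow> nat \<Rightarrow> nat \<Rightarrow> nat \<Rightarrow> int \<Rightarrow> nat + nat \<times> nat \<Rightarrow> nat \<Rightarrow> int" where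
  "seq_coord p n l t r x j q = (let \<theta> = length (simplex p l) in case j of
      Inl i \<Rightarrow> if q = r then if i = r then 1 else if i < t * \<theta> then x else 0 else of_bool (q = i)
    | Inr (b, j) \<Rightarrow> if q = r then int (n div p) * x
        else if q div \<theta> = b then - int (n div p) * (simplex p l ! (q mod \<theta>)) j else 0)"

text \<open>The first \<open>r\<close> coordinates express the multiplicities of the generators
  through the words. The last one then counts the blocks with a nonzero word, and this count is too
  small to wrap around modulo \<open>k\<^sub>1 * m\<close>.\<close>

lemma zero_sum_free_family:
  fixes r n p k\<^sub>1 m l t :: nat and x :: int and c :: "nat + nat \<times> nat \<Rightarrow> nat"
  defines "\<theta> \<equiv> length (simplex p l)"
  defines "s \<equiv> n div p"
  defines "W \<equiv> if p = 2 then 2 ^ (l - 1) else int p ^ l"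
  defines "w \<equiv> seq_coord p n l t r x"
  assumes "prime p" "p dvd n" "0 < n" "0 < m" "t < k\<^sub>1" "0 < \<theta>" "t * \<theta> \<le> r"
    and x: "int (k\<^sub>1 * m) dvd int s * x * W - int m"
    and c: "\<And>i. i < r \<Longrightarrow> c (Inl i) < n" "c (Inl r) < (k\<^sub>1 - t) * m"
      "\<And>b j. b < t \<Longrightarrow> j < l \<Longrightarrow> c (Inr (b, j)) < p"
    and zero: "\<And>q. q < r \<Longrightarrow> int n dvd (\<Sum>j\<in>{..r} <+> {..<t} \<times> {..<l}. int (c j) * w j q)"
      "int (k\<^sub>1 * m) dvd (\<Sum>j\<in>{..r} <+> {..<t} \<times> {..<l}. int (c j) * w j r)"
    and j: "j \<in> {..r} <+> {..<t} \<times> {..<l}"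
  shows "c j = 0"
proof -
  note w = seq_coord_def[of p n l t r x, folded w_def \<theta>_def s_def, unfolded Let_def]
  define d where "d b j = int (c (Inr (b, j)))" for b j
  define e where "e i = int (c (Inl i))" for i
  \<comment> \<open>The entry at generator \<open>q\<close> of the word that the additional terms of
    its block spell; 0 outside the \<open>t\<close> blocks.\<close>
  define u where "u q = (if q div \<theta> < t then dot l (simplex p l ! (q mod \<theta>)) (d (q div \<theta>)) else 0)" for q
  have p: "2 \<le> p" using \<open>prime p\<close> by (rule prime_ge_2_nat)
  have sp: "int n = int s * int p" "0 < s"
    using \<open>p dvd n\<close> \<open>0 < n\<close> p by (auto simp: s_def)
  have split: "(\<Sum>j\<in>{..r} <+> {..<t} \<times> {..<l}. int (c j) * w j q)
    = (\<Sum>i\<le>r. e i * w (Inl i) q) + (\<Sum>b<t. \<Sum>j<l. d b j * w (Inr (b, j)) q)" for q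
    by (simp add: sum.Plus e_def d_def o_def sum.cartesian_product)
  \<comment> \<open>The minus sign in \<open>seq_coord\<close> makes \<open>e q\<close> congruent to
    \<open>s * u q\<close> modulo \<open>n = s * p\<close>, and \<open>e q < n\<close> turns the
    congruence into an equality with the residue.\<close>
  have coord: "e q = int s * (u q mod int p)" if "q < r" for q
  proof -
    have "(\<Sum>b<t. \<Sum>j<l. d b j * w (Inr (b, j)) q)
        = (\<Sum>b<t. if q div \<theta> = b then - int s * dot l (simplex p l ! (q mod \<theta>)) (d b) else 0)"
      using that by (intro sum.cong refl) (auto simp: w sum_distrib_left intro!: sum.cong)
    also have "\<dots> = - int s * u q" by (simp add: u_def)
    finally have *: "(\<Sum>b<t. \<Sum>j<l. d b j * w (Inr (b, j)) q) = - int s * u q" .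
    have "(\<Sum>i\<le>r. e i * w (Inl i) q) = (\<Sum>i\<le>r. if q = i then e i else 0)"
      using that by (intro sum.cong) (auto simp: w)
    also have "\<dots> = e q" using that by simp
    finally have "int n dvd e q - int s * u q"
      using zero(1)[OF that] unfolding split * by simp
    then have "e q mod int n = (int s * u q) mod int n"
      by (simp add: mod_eq_dvd_iff)
    moreover have "e q mod int n = e q" using c(1)[OF that] by (simp add: e_def)
    ultimately have "e q = (int s * u q) mod int n" by linarith
    then show ?thesis unfolding mult_mod_right sp(1)[symmetric] .
  qed
  define B where "B = card {b. b < t \<and> (\<exists>j<l. d b j \<noteq> 0)}"
  \<comment> \<open>Blockwise this is \<open>simplex_weight\<close>: the additional terms, each
    counted \<open>s\<close> times, stand in for the missing unit vectors. A block with zero word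
    contributes nothing.\<close>
  have "(\<Sum>i<t * \<theta>. e i) + int s * (\<Sum>b<t. \<Sum>j<l. d b j) = int s * W * int B"
  proof -
    have "(\<Sum>i<t * \<theta>. e i) = (\<Sum>b<t. \<Sum>i\<in>{b * \<theta>..<b * \<theta> + \<theta>}. e i)"
      by (rule sum.nat_group[symmetric])
    also have "\<dots> = (\<Sum>b<t. int s * (\<Sum>v\<leftarrow>simplex p l. dot l v (d b) mod int p))"
    proof (rule sum.cong[OF refl])
      fix b assume b: "b \<in> {..<t}"
      have "b * \<theta> + \<theta> \<le> t * \<theta>" using b mult_le_mono1[of "Suc b" t \<theta>] by simp
      then have less: "b * \<theta> + i < r" if "i < \<theta>" for i
        using that \<open>t * \<theta> \<le> r\<close> by linarith
      have "(\<Sum>i\<in>{b * \<theta>..<b * \<theta> + \<theta>}. e i) = (\<Sum>i<\<theta>. e (b * \<theta> + i))"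
        using sum.shift_bounds_nat_ivl[of e 0 "b * \<theta>" \<theta>] by (simp add: add.commute atLeast0LessThan)
      also have "\<dots> = (\<Sum>i<\<theta>. int s * (dot l (simplex p l ! i) (d b) mod int p))"
        using less b by (intro sum.cong) (auto simp: coord u_def)
      also have "\<dots> = int s * (\<Sum>v\<leftarrow>simplex p l. dot l v (d b) mod int p)"
        by (simp add: sum_distrib_left sum_list_sum_nth atLeast0LessThan \<theta>_def)
      finally show "(\<Sum>i\<in>{b * \<theta>..<b * \<theta> + \<theta>}. e i) = int s * (\<Sum>v\<leftarrow>simplex p l. dot l v (d b) mod int p)" .
    qed
    finally have "(\<Sum>i<t * \<theta>. e i) + int s * (\<Sum>b<t. \<Sum>j<l. d b j)
      = int s * (\<Sum>b<t. (\<Sum>v\<leftarrow>simplex p l. dot l v (d b) mod int p) + (\<Sum>j<l. d b j))"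
      by (simp add: sum_distrib_left sum.distrib distrib_left)
    also have "(\<Sum>b<t. (\<Sum>v\<leftarrow>simplex p l. dot l v (d b) mod int p) + (\<Sum>j<l. d b j))
      = (\<Sum>b<t. if \<exists>j<l. d b j \<noteq> 0 then W else 0)"
    proof (rule sum.cong[OF refl])
      fix b assume b: "b \<in> {..<t}"
      show "(\<Sum>v\<leftarrow>simplex p l. dot l v (d b) mod int p) + (\<Sum>j<l. d b j) = (if \<exists>j<l. d b j \<noteq> 0 then W else 0)"
      proof (cases "\<exists>j<l. d b j \<noteq> 0")
        case True
        then show ?thesis
          using simplex_weight[OF \<open>prime p\<close>, of l "d b"] c(3) b by (simp add: W_def d_def)
      qed (auto simp: sum_list_0)
    qed
    also have "\<dots> = W * int B"
      by (simp add: B_def sum.If_cases Int_def)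
    finally show ?thesis by (simp add: mult.assoc)
  qed
  moreover have "(\<Sum>i\<le>r. e i * w (Inl i) r) = e r + x * (\<Sum>i<t * \<theta>. e i)"
  proof -
    have "(\<Sum>i<r. e i * w (Inl i) r) = (\<Sum>i<t * \<theta>. e i * x)"
      using \<open>t * \<theta> \<le> r\<close> by (intro sum.mono_neutral_cong_right) (auto simp: w)
    then show ?thesis
      by (simp add: lessThan_Suc_atMost[symmetric] w sum_distrib_left mult.commute)
  qed
  \<comment> \<open>An additional term is as heavy in direction \<open>f\<close> as \<open>s\<close>
    translated generators, so both sums combine into the identity for \<open>B\<close>.\<close>
  moreover have "(\<Sum>b<t. \<Sum>j<l. d b j * w (Inr (b, j)) r) = x * (int s * (\<Sum>b<t. \<Sum>j<l. d b j))"
    by (simp add: w sum_distrib_left mult_ac)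
  ultimately have "(\<Sum>j\<in>{..r} <+> {..<t} \<times> {..<l}. int (c j) * w j r) = e r + x * (int s * W * int B)"
    unfolding split by (simp add: distrib_left[symmetric] add.assoc)
  \<comment> \<open>By the choice of \<open>x\<close>, each nonzero word amounts to \<open>m\<close>
    copies of \<open>f\<close> modulo \<open>k\<^sub>1 * m\<close>.\<close>
  also have "\<dots> = (e r + int m * int B) + (int s * x * W - int m) * int B"
    by (simp add: algebra_simps)
  finally have "int (k\<^sub>1 * m) dvd (e r + int m * int B) + (int s * x * W - int m) * int B"
    using zero(2) by simp
  then have "int (k\<^sub>1 * m) dvd e r + int m * int B"
    using x by (simp add: dvd_add_left_iff)
  then have "k\<^sub>1 * m dvd c (Inl r) + m * B"
    by (simp add: e_def flip: of_nat_mult of_nat_add)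
  \<comment> \<open>As \<open>B \<le> t\<close>, the blocks need at most the room left by the
    \<open>t * m\<close> omitted copies of \<open>f\<close>.\<close>
  moreover have "c (Inl r) + m * B < k\<^sub>1 * m"
  proof -
    have "B \<le> card {..<t}" unfolding B_def by (intro card_mono) auto
    then have "m * B \<le> t * m" by simp
    moreover have "(k\<^sub>1 - t) * m + t * m = k\<^sub>1 * m"
      using \<open>t < k\<^sub>1\<close> by (simp add: distrib_right[symmetric])
    ultimately show ?thesis using c(2) by linarith
  qed
  ultimately have "c (Inl r) + m * B = 0"
    by (metis dvd_imp_le gr0I not_le)
  then have er: "c (Inl r) = 0" and B: "B = 0" using \<open>0 < m\<close> by auto
  then have "d b j = 0" if "b < t" "j < l" for b j
    using that by (auto simp: B_def)
  then have d0: "c (Inr (b, j)) = 0" if "b < t" "j < l" for b j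
    using that by (auto simp: d_def)
  have u0: "u q = 0" for q
    by (auto simp: u_def d_def d0)
  have "c (Inl i) = 0" if "i < r" for i
    using coord[OF that] by (simp add: u0 e_def)
  then show ?thesis using j er d0 by (auto simp: le_less)
qed

section \<open>Choice of the parameters and comparison of lengths\<close>

theorem theorem4p3:
  fixes G :: "('a, 'b) monoid_scheme" and r n k p k\<^sub>1 m l t :: nat
  assumes "comm_group G"
    and "G \<cong> product_group {..<r} (\<lambda>_. integer_mod_group n) \<times>\<times> integer_mod_group (k * n)"
    and "1 \<le> r" and "2 \<le> n" and "2 \<le> k"
    and "\<not> primepow (order G)"
    and "prime p" and "p dvd n"
    and "2 \<le> k\<^sub>1" and "k\<^sub>1 dvd k" and "gcd p k\<^sub>1 = 1"
    and "k * n = k\<^sub>1 * m"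
    and "1 \<le> l" and "t \<in> {1..k\<^sub>1 - 1}"
    and "int t * theta l p \<le> int r" and "1 \<le> int t * theta l p"
  shows "int (davenport G) \<ge>
    int (davenport_star G) + int t * (int p - 1) * int l - int t * int m"
proof -
  define \<theta> where "\<theta> = length (simplex p l)"
  have \<theta>: "int \<theta> = theta l p" unfolding \<theta>_def using \<open>prime p\<close> by (rule length_simplex)
  have "int (t * \<theta>) \<le> int r" "1 \<le> int (t * \<theta>)" using assms(15,16) by (simp_all add: \<theta>)
  then have t\<theta>: "t * \<theta> \<le> r" "0 < \<theta>"
    by (simp_all only: of_nat_le_iff) (cases \<theta>; simp)
  have t: "1 \<le> t" "t < k\<^sub>1" using assms(9,14) by auto
  have p: "2 \<le> p" using \<open>prime p\<close> by (rule prime_ge_2_nat)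
  obtain k' where k': "k = k\<^sub>1 * k'" using \<open>k\<^sub>1 dvd k\<close> by (auto simp: dvd_def)
  then have m: "m = k' * n" using assms(9,12) by simp
  have "0 < m" using m k' assms(4,5) by (cases k') auto
  \<comment> \<open>For \<open>p = 2\<close>, a nonzero form has value 1 at
    \<open>2 ^ (l - 1)\<close> points; for odd \<open>p\<close>, it is nonzero on
    \<open>p ^ (l - 1)\<close> opposite pairs, whose residues add up to \<open>p\<close>.\<close>
  define W where "W = (if p = 2 then 2 ^ (l - 1) else int p ^ l)"
  obtain x where x: "int (k\<^sub>1 * m) dvd int (n div p) * x * W - int m"
  proof -
    have "W = int p ^ (if p = 2 then l - 1 else l)" by (simp add: W_def)
    moreover have "coprime p k\<^sub>1" using assms(11) by (simp add: coprime_iff_gcd_eq_1)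
    moreover have "n dvd m" by (simp add: m)
    ultimately show ?thesis
      using height_exists[of p k\<^sub>1 n m "if p = 2 then l - 1 else l"] \<open>p dvd n\<close> that by metis
  qed
  let ?ns = "replicate r n @ [k * n]"
  have inv: "invariant_factors G ?ns" using assms(2,4,5) by (rule rank_invariant_factors)
  define J where "J = {..r} <+> {..<t} \<times> {..<l}"
  \<comment> \<open>The multiplicity of \<open>f\<close> is \<open>k * n - 1 - t * m\<close>,
    rewritten with \<open>k * n = k\<^sub>1 * m\<close>; \<open>pos\<close> below ensures that its
    final subtraction is not truncated.\<close>
  define N where "N j = (case j of Inl i \<Rightarrow> if i < r then n - 1 else (k\<^sub>1 - t) * m - 1
    | Inr _ \<Rightarrow> p - 1)" for j :: "nat + nat \<times> nat"
  have pos: "0 < (k\<^sub>1 - t) * m" using t \<open>0 < m\<close> by simp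
  have "(\<Sum>j\<in>J. N j) < davenport G"
  proof (rule davenport_gt_coordinates)
    show "G \<cong> product_group {..<length ?ns} (\<lambda>i. integer_mod_group (?ns ! i))"
      using inv by (simp only: invariant_factors_def)
    show "0 < ?ns ! i" if "i \<in> {..<length ?ns}" for i
      using that assms(4,5) by (auto simp: nth_append)
    fix c j
    assume c: "\<And>j. j \<in> J \<Longrightarrow> c j \<le> N j" and j: "j \<in> J"
      and zero: "\<And>i. i \<in> {..<length ?ns} \<Longrightarrow>
        int (?ns ! i) dvd (\<Sum>j\<in>J. int (c j) * seq_coord p n l t r x j i)"
    have Inl: "Inl i \<in> J" if "i \<le> r" for i
      using that by (auto simp: J_def)
    have Inr: "Inr (b, i) \<in> J" if "b < t" "i < l" for b i
      using that by (auto simp: J_def)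
    show "c j = 0"
    proof (rule zero_sum_free_family[of p n m t k\<^sub>1 l r x c j, folded \<theta>_def J_def W_def])
      show "c (Inl i) < n" if "i < r" for i
        using c[OF Inl, of i] that assms(4) by (simp add: N_def)
      show "c (Inl r) < (k\<^sub>1 - t) * m"
      proof -
        have "c (Inl r) \<le> (k\<^sub>1 - t) * m - 1" using c[OF Inl, of r] by (simp add: N_def)
        then show ?thesis using pos by linarith
      qed
      show "c (Inr (b, i)) < p" if "b < t" "i < l" for b i
        using c[OF Inr, OF that] p by (simp add: N_def)
      show "int n dvd (\<Sum>j\<in>J. int (c j) * seq_coord p n l t r x j q)" if "q < r" for q
        using zero[of q] that by (simp add: nth_append)
      show "int (k\<^sub>1 * m) dvd (\<Sum>j\<in>J. int (c j) * seq_coord p n l t r x j r)"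
        using zero[of r] by (simp add: nth_append assms(12))
    qed (use assms(4,7,8) t t\<theta> \<open>0 < m\<close> x j in auto)
  qed (use assms(1) in \<open>auto simp: J_def\<close>)
  moreover have "(\<Sum>j\<in>J. N j) = r * (n - 1) + ((k\<^sub>1 - t) * m - 1) + t * l * (p - 1)"
    by (simp add: J_def N_def sum.Plus o_def flip: lessThan_Suc_atMost)
  \<comment> \<open>The strict inequality makes up for the 1 subtracted in the multiplicity of
    \<open>f\<close>.\<close>
  ultimately have "r * (n - 1) + (k\<^sub>1 - t) * m + t * l * (p - 1) \<le> davenport G"
    using pos by linarith
  then have "int (r * (n - 1) + (k\<^sub>1 - t) * m + t * l * (p - 1)) \<le> int (davenport G)"
    by (simp only: of_nat_le_iff)
  moreover have "davenport_star G = r * (n - 1) + k\<^sub>1 * m"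
  proof -
    have "0 < k * n" using assms(4,5) by simp
    then show ?thesis
      using davenport_star_eq[OF comm_group.axioms(2)[OF assms(1)] inv] assms(12)
      by (simp add: sum_list_replicate)
  qed
  \<comment> \<open>These substitutions remove the truncated subtractions
    \<open>k\<^sub>1 - t\<close> and \<open>p - 1\<close> from the final comparison.\<close>
  moreover obtain a b where "k\<^sub>1 = t + a" "p = Suc b"
    using t(2) p by (metis less_imp_add_positive Suc_le_D numeral_2_eq_2)
  ultimately show ?thesis by (simp add: algebra_simps)
qed

end
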